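(* Consider a tokenizer with character alphabet $\Sigma$, token ID alphabet $\mathbb{N}=\{0,1,\dots,|V|-1\}$ and tokenization function $f_{\text{tok}}:\Sigma^*\to\mathbb{N}^*$, and let $L\subseteq\Sigma^*$ be a context-free or regular language. Then the proper tokenization language $L'$ of $L$ is a subset of the extended tokenization language $L'_E$ of $L$; more specifically, $L'=L'_E\cap\mathbb{N}_{\text{proper}}^*$, where $\mathbb{N}_{\text{proper}}^*$ is the proper tokenization space.
   Context: Here $\mathbb{N}$ does not denote the natural numbers. A tokenizer has a finite character alphabet $\Sigma$ and a finite vocabulary $V$ of tokens, which are strings over $\Sigma$, indexed by the token IDs in the finite alphabet $\mathbb{N}=\{0,1,\dots,|V|-1\}$; let $\tau:\mathbb{N}\to\Sigma^*$ send each token ID to its token. The detokenization function is $f_{\text{detok}}:\mathbb{N}^*\to\Sigma^*$, $f_{\text{detok}}(n_1\cdots n_k)=\tau(n_1)\cdots\tau(n_k)$. The tokenization function $f_{\text{tok}}:\Sigma^*\to\mathbb{N}^*$ gives the unique (proper) tokenization returned by the tokenizer and satisfies $f_{\text{detok}}(f_{\text{tok}}(x))=x$ for all $x\in\Sigma^*$. The extended tokenization function $F_{\text{tok}}$ maps $s\in\Sigma^*$ to the set of all its valid tokenizations, i.e. of all $t\in\mathbb{N}^*$ with $f_{\text{detok}}(t)=s$. The proper tokenization space is the image $\mathbb{N}_{\text{proper}}^*=f_{\text{tok}}(\Sigma^* )\subseteq\mathbb{N}^*$ (here the star is part of the notation, not a Kleene star). The proper tokenization language of $L$ is $L'=f_{\text{tok}}(L)=\{f_{\text{tok}}(s):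 s\in L\}$, and the extended tokenization language of $L$ is $L'_E=\bigcup_{s\in L}F_{\text{tok}}(s)$. *)

theory Defs
  imports "HOL-Library.FuncSet"
begin

text \<open>
  An alphabet is a carrier set \<open>\<Sigma>\<close> and \<open>\<Sigma>\<^sup>*\<close> is \<open>lists \<Sigma>\<close>. Nonterminals and states are taken from
  \<open>nat\<close>: a grammar or automaton has only finitely many of them, so this is just a choice of names.
\<close>

datatype 'c symbol = NT nat | Tm 'c

definition cfg :: "'c set \<Rightarrow> nat set \<Rightarrow> (nat \<times> 'c symbol list) set \<Rightarrow> nat \<Rightarrow> bool" where
  "cfg \<Sigma> N P S \<longleftrightarrow> finite N \<and> S \<in> N \<and> finite P \<and> P \<subseteq> N \<times> lists (NT ` N \<union> Tm ` \<Sigma>)"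

definition derives1 :: "(nat \<times> 'c symbol list) set \<Rightarrow> ('c symbol list \<times> 'c symbol list) set" where
  "derives1 P = {(u @ [NT A] @ v, u @ \<alpha> @ v) | u A \<alpha> v. (A, \<alpha>) \<in> P}"

definition cfg_language :: "(nat \<times> 'c symbol list) set \<Rightarrow> nat \<Rightarrow> 'c list set" where
  "cfg_language P S = {w. ([NT S], map Tm w) \<in> (derives1 P)\<^sup>*}"

definition context_free_language :: "'c set \<Rightarrow> 'c list set \<Rightarrow> bool" where
  "context_free_language \<Sigma> L \<longleftrightarrow> (\<exists>N P S. cfg \<Sigma> N P S \<and> L = cfg_language P S)"

definition dfa :: "'c set \<Rightarrow> nat set \<Rightarrow> (nat \<Rightarrow> 'c \<Rightarrow> nat) \<Rightarrow> nat \<Rightarrow> nat set \<Rightarrow> bool" where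
  "dfa \<Sigma> Q \<delta> q0 F \<longleftrightarrow> finite Q \<and> q0 \<in> Q \<and> F \<subseteq> Q \<and> (\<forall>q\<in>Q. \<forall>c\<in>\<Sigma>. \<delta> q c \<in> Q)"

definition dfa_language :: "'c set \<Rightarrow> (nat \<Rightarrow> 'c \<Rightarrow> nat) \<Rightarrow> nat \<Rightarrow> nat set \<Rightarrow> 'c list set" where
  "dfa_language \<Sigma> \<delta> q0 F = {w \<in> lists \<Sigma>. foldl \<delta> q0 w \<in> F}"

definition regular_language :: "'c set \<Rightarrow> 'c list set \<Rightarrow> bool" where
  "regular_language \<Sigma> L \<longleftrightarrow> (\<exists>Q \<delta> q0 F. dfa \<Sigma> Q \<delta> q0 F \<and> L = dfa_language \<Sigma> \<delta> q0 F)"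

definition token_ids :: "'c list set \<Rightarrow> nat set" where
  "token_ids V = {..<card V}"

definition detok :: "(nat \<Rightarrow> 'c list) \<Rightarrow> nat list \<Rightarrow> 'c list" where
  "detok \<tau> t = concat (map \<tau> t)"

text \<open>
  Functions are total in HOL: \<open>\<tau>\<close> matters only on \<open>token_ids V\<close> and \<open>f_tok\<close> only on \<open>lists \<Sigma>\<close>.
\<close>

definition tokenizer ::
    "'c set \<Rightarrow> 'c list set \<Rightarrow> (nat \<Rightarrow> 'c list) \<Rightarrow> ('c list \<Rightarrow> nat list) \<Rightarrow> bool" where
  "tokenizer \<Sigma> V \<tau> f_tok \<longleftrightarrow>
     finite \<Sigma> \<and> finite V \<and> V \<subseteq> lists \<Sigma> \<and> bij_betw \<tau> (token_ids V) V \<and>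
     f_tok \<in> lists \<Sigma> \<rightarrow> lists (token_ids V) \<and>
     (\<forall>x \<in> lists \<Sigma>. detok \<tau> (f_tok x) = x)"

definition extended_tok :: "'c list set \<Rightarrow> (nat \<Rightarrow> 'c list) \<Rightarrow> 'c list \<Rightarrow> nat list set" where
  "extended_tok V \<tau> s = {t \<in> lists (token_ids V). detok \<tau> t = s}"

definition proper_tokenization_space :: "'c set \<Rightarrow> ('c list \<Rightarrow> nat list) \<Rightarrow> nat list set" where
  "proper_tokenization_space \<Sigma> f_tok = f_tok ` lists \<Sigma>"

definition proper_tokenization_language ::
    "('c list \<Rightarrow> nat list) \<Rightarrow> 'c list set \<Rightarrow> nat list set" where
  "proper_tokenization_language f_tok L = f_tok ` L"

definition extended_tokenization_language ::
    "'c list set \<Rightarrow> (nat \<Rightarrow> 'c list) \<Rightarrow> 'c list set \<Rightarrow> nat list set" where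
  "extended_tokenization_language V \<tau> L = (\<Union>s\<in>L. extended_tok V \<tau> s)"

end

theory Submission
  imports Defs
begin

text \<open>On \<open>lists \<Sigma>\<close>, \<open>detok \<tau>\<close> is a left inverse of
  \<open>f_tok\<close>, so a proper tokenization \<open>f_tok s\<close> determines its source
  \<open>s\<close>. The extended language is the preimage of \<open>L\<close> under detokenization,
  within the strings of token IDs. Hence \<open>f_tok s\<close> lies in it exactly when
  \<open>s\<close> is in \<open>L\<close>, which is the claimed equality; the inclusion follows from
  it.\<close>

theorem proposition5p1:
  fixes \<Sigma> :: "'c set"
    and V :: "'c list set"
    and \<tau> :: "nat \<Rightarrow> 'c list"
    and f_tok :: "'c list \<Rightarrow> nat list"
    and L :: "'c list set"
  assumes "tokenizer \<Sigma> V \<tau> f_tok"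
    and "L \<subseteq> lists \<Sigma>"
    and "context_free_language \<Sigma> L \<or> regular_language \<Sigma> L"
  shows "proper_tokenization_language f_tok L \<subseteq> extended_tokenization_language V \<tau> L \<and>
         proper_tokenization_language f_tok L =
           extended_tokenization_language V \<tau> L \<inter> proper_tokenization_space \<Sigma> f_tok"
proof -
  have closed: "f_tok x \<in> lists (token_ids V)" if "x \<in> lists \<Sigma>" for x
    using assms(1) that by (simp only: tokenizer_def Pi_iff)
  have section_eq: "detok \<tau> (f_tok x) = x" if "x \<in> lists \<Sigma>" for x
    using assms(1) that by (simp only: tokenizer_def)
  \<comment> \<open>The union over \<open>L\<close> collapses: the only string that \<open>t\<close>
    can tokenize is \<open>detok \<tau> t\<close>.\<close>
  have ext_iff: "t \<in> extended_tokenization_language V \<tau> L \<longleftrightarrow>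
      t \<in> lists (token_ids V) \<and> detok \<tau> t \<in> L" for t
    by (simp add: extended_tokenization_language_def extended_tok_def)
  have "t \<in> extended_tokenization_language V \<tau> L \<inter> proper_tokenization_space \<Sigma> f_tok"
    if "t \<in> proper_tokenization_language f_tok L" for t
  proof -
    from that obtain s where s: "s \<in> L" "t = f_tok s"
      by (auto simp only: proper_tokenization_language_def)
    \<comment> \<open>\<open>closed\<close> and \<open>section_eq\<close> are available only for
      strings over \<Sigma>.\<close>
    with assms(2) have "s \<in> lists \<Sigma>" by blast
    with s show ?thesis
      by (simp only: Int_iff ext_iff proper_tokenization_space_def closed section_eq imageI simp_thms)
  qed
  moreover have "t \<in> proper_tokenization_language f_tok L"
    if "t \<in> extended_tokenization_language V \<tau> L \<inter> proper_tokenization_space \<Sigma> f_tok" for t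
  proof -
    from that obtain s where s: "s \<in> lists \<Sigma>" "t = f_tok s"
      by (auto simp only: proper_tokenization_space_def)
    \<comment> \<open>Properness yields only some source \<open>s\<close> over \<Sigma>, not yet in
      \<open>L\<close>; detokenizing \<open>t\<close> gives back this very \<open>s\<close>, which
      puts it in \<open>L\<close>.\<close>
    from that have "detok \<tau> t \<in> L" by (simp only: Int_iff ext_iff)
    with s have "s \<in> L" by (simp only: section_eq)
    with s(2) show ?thesis by (simp only: proper_tokenization_language_def imageI)
  qed
  ultimately show ?thesis by blast
qed

end
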